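(* Let $L$ be a compact Hausdorff space. Then $$sw(L)=\begin{cases}|L| & \text{if } L \text{ is finite},\\ w(L)^{\aleph_0} & \text{if } L \text{ is infinite}.\end{cases}$$
   Context: $sw(L):=\dim(\mathcal{C}(L,\mathbb{K}))$ is the Stone-Weierstrass character of $L$: the algebraic dimension over $\mathbb{K}$ of the space of continuous functions $L\to\mathbb{K}$, where $\mathbb{K}$ is $\mathbb{R}$ or $\mathbb{C}$ (the value does not depend on this choice). $w(L)$ is the topological weight of $L$, i.e. the least cardinality of a base of the topology of $L$. *)

theory Defs
  imports "HOL-Analysis.Analysis" "HOL-Library.Function_Algebras"
begin

unbundle cardinal_syntax

(* The library's "dim" is a natural number (0 for infinite-dimensional spaces); this is its
   cardinal-valued counterpart. As usual in HOL, a cardinal is a cardinal order, compared by =o. *)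
definition (in vector_space) hamel_dim :: "'b set \<Rightarrow> 'b rel" where
  "hamel_dim V = |SOME B. independent B \<and> span B = span V|"

lemma (in vector_space) hamel_dim_unique:
  assumes "independent B" "span B = span V"
  shows "hamel_dim V =o |B|"
proof -
  let ?C = "SOME B. independent B \<and> span B = span V"
  have "independent ?C \<and> span ?C = span V"
    using assms by (rule someI2[of _ B, OF conjI])
  with assms obtain f where "bij_betw f ?C B"
    using bij_if_span_eq_span_bases[of ?C B] by auto
  then show ?thesis
    unfolding hamel_dim_def by (meson card_of_ordIso)
qed

lemma (in vector_space) hamel_basis_exists:
  obtains B where "independent B" "span B = span V"
  by (meson maximal_independent_subset span_eq span_superset subset_trans)

definition fun_scale :: "'k::field \<Rightarrow> ('a \<Rightarrow> 'k) \<Rightarrow> 'a \<Rightarrow> 'k" where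
  "fun_scale c f = (\<lambda>x. c * f x)"

global_interpretation fun_vs: vector_space "fun_scale :: 'k::field \<Rightarrow> ('a \<Rightarrow> 'k) \<Rightarrow> 'a \<Rightarrow> 'k"
  by unfold_locales (auto simp: fun_scale_def fun_eq_iff algebra_simps)

(* A continuous function on the carrier of X is represented by its extension by 0 to the
   whole type, so that the representation is unique and compatible with pointwise operations. *)
definition cont_funs :: "'a topology \<Rightarrow> ('a \<Rightarrow> 'k::real_normed_field) set" where
  "cont_funs X = {f. continuous_map X euclidean f \<and> (\<forall>x. x \<notin> topspace X \<longrightarrow> f x = 0)}"

lemma subspace_cont_funs:
  fixes X :: "'a topology"
  shows "fun_vs.subspace (cont_funs X :: ('a \<Rightarrow> 'k::real_normed_field) set)"
proof -
  have "continuous_map X euclidean (f + g)"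
    if "continuous_map X euclidean f" "continuous_map X euclidean g" for f g :: "'a \<Rightarrow> 'k"
    using continuous_map_add[OF that] by (simp add: plus_fun_def)
  moreover have "continuous_map X euclidean (fun_scale c f)"
    if f: "continuous_map X euclidean f" for c and f :: "'a \<Rightarrow> 'k"
  proof -
    have "continuous_map X euclidean ((*) c \<circ> f)"
      by (rule continuous_map_compose[OF f]) (auto intro!: continuous_intros)
    then show ?thesis
      by (simp add: o_def fun_scale_def)
  qed
  ultimately show ?thesis
    by (auto simp: fun_vs.subspace_def cont_funs_def fun_scale_def zero_fun_def)
qed

(* The scalar field is determined by the result type. *)
definition sw :: "'a topology \<Rightarrow> ('a \<Rightarrow> 'k::real_normed_field) rel" where
  "sw X = fun_vs.hamel_dim (cont_funs X)"

definition base_of :: "'a topology \<Rightarrow> 'a set set \<Rightarrow> bool" where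
  "base_of X \<B> \<longleftrightarrow> openin X = arbitrary union_of (\<lambda>U. U \<in> \<B>)"

definition weight :: "'a topology \<Rightarrow> 'a set rel" where
  "weight X = |SOME \<B>. base_of X \<B> \<and> (\<forall>\<C>. base_of X \<C> \<longrightarrow> |\<B>| \<le>o |\<C>| )|"

lemma weight_base:
  obtains \<B> where "base_of X \<B>" "weight X = |\<B>|" "\<And>\<C>. base_of X \<C> \<Longrightarrow> |\<B>| \<le>o |\<C>|"
proof -
  have "arbitrary union_of (\<lambda>U. U \<in> {U. openin X U}) = openin X"
    by (auto simp: fun_eq_iff arbitrary_def intro: union_of_inc elim!: union_of_mono)
       (auto simp: union_of_def)
  then have ne: "{|\<B>| |\<B>. base_of X \<B>} \<noteq> {}"
    by (auto simp: base_of_def intro!: exI[of _ "{U. openin X U}"])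
  have "\<forall>r\<in>{|\<B>| |\<B>. base_of X \<B>}. Card_order r"
    using card_of_Card_order by blast
  from exists_minim_Card_order[OF ne this]
  have "\<exists>\<B>. base_of X \<B> \<and> (\<forall>\<C>. base_of X \<C> \<longrightarrow> |\<B>| \<le>o |\<C>| )"
    by blast
  from someI_ex[OF this] show thesis
    using that unfolding weight_def by blast
qed

end

theory Submission
  imports Defs "HOL-Algebra.Free_Abelian_Groups"
begin

text \<open>
  For finite \<open>L\<close> the topology is discrete and the indicators of points form a basis of
  \<open>C(L)\<close>. Let \<open>L\<close> be infinite, with weight \<open>w\<close>. All three quantities \<open>dim C(L)\<close>,
  \<open>|C(L)|\<close> and \<open>w\<^sup>\<omega>\<close> turn out to be equal.

  \<^emph>\<open>Upper bound\<close> \<open>|C(L)| \<le> w\<^sup>\<omega>\<close> (\<open>card_cont_funs_le_weight_cexp\<close>). Fix a base of cardinality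
  \<open>w\<close>. If \<open>q\<close> runs through a countable dense set of scalars and \<open>r\<close> through the numbers \<open>1/n\<close>,
  then between the compact set of points that \<open>f\<close> maps into the closed ball of radius \<open>r\<close> around
  \<open>q\<close> and the open set of points mapped into the open ball of radius \<open>2 r\<close> there is a finite union
  of base sets. These countably many finite unions determine \<open>f\<close>, and an infinite base has only
  \<open>w\<close> finite subsets.

  \<^emph>\<open>Lower bound\<close> \<open>w\<^sup>\<omega> \<le> |C(L)|\<close> (\<open>weight_cexp_le_card_cont_funs\<close>). Take a maximal set \<open>A\<close> of
  continuous functions \<open>L \<rightarrow> [0,1]\<close> with mutual sup-distances at least \<open>1/2\<close>. By maximality every
  Urysohn function is within \<open>1/2\<close> of a member of \<open>A\<close>, so that the sets \<open>{g > 1/2}\<close> for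
  \<open>g \<in> A\<close> form a base; hence \<open>w \<le> |A|\<close>. On the other hand the sums
  \<open>s 0 + s 1 / 8 + s 2 / 64 + ...\<close> are distinct for distinct sequences \<open>s\<close> in \<open>A\<close>, because at the
  first difference the terms are too far apart for the tails to compensate.

  \<^emph>\<open>Dimension\<close> (\<open>sw_infinite\<close>). A vector space over a field of at most continuum size with an
  infinite basis of at least continuum size has the same cardinality as the basis. It remains to find
  continuum many linearly independent functions (\<open>continuum_independent_cont_funs\<close>): these are the
  powers \<open>g\<^sup>t\<close>, \<open>t > 0\<close>, of a function \<open>g \<ge> 0\<close> with arbitrarily small positive values, where in
  a vanishing linear combination the lowest power would dominate.
\<close>

section \<open>Bases of topologies and cardinalities\<close>

lemma base_of_iff:
  "base_of X \<B> \<longleftrightarrow>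
     (\<forall>V\<in>\<B>. openin X V) \<and> (\<forall>U x. openin X U \<longrightarrow> x \<in> U \<longrightarrow> (\<exists>V\<in>\<B>. x \<in> V \<and> V \<subseteq> U))"
  (is "?L \<longleftrightarrow> ?R")
proof
  assume ?L
  then have o: "openin X = arbitrary union_of (\<lambda>U. U \<in> \<B>)"
    by (simp add: base_of_def)
  have "openin X V" if "V \<in> \<B>" for V
    unfolding o using that by (simp add: arbitrary_union_of_inc)
  moreover have "\<exists>V\<in>\<B>. x \<in> V \<and> V \<subseteq> U" if "openin X U" "x \<in> U" for U x
  proof -
    have "(arbitrary union_of (\<lambda>U. U \<in> \<B>)) U"
      using that(1) by (simp add: o)
    then show ?thesis
      using that(2) unfolding arbitrary_union_of_alt by blast
  qed
  ultimately show ?R by blast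
next
  assume R: ?R
  show ?L
    unfolding base_of_def
  proof
    fix U show "openin X U = (arbitrary union_of (\<lambda>U. U \<in> \<B>)) U"
    proof
      assume "openin X U"
      then show "(arbitrary union_of (\<lambda>U. U \<in> \<B>)) U"
        unfolding arbitrary_union_of_alt using R by blast
    next
      assume "(arbitrary union_of (\<lambda>U. U \<in> \<B>)) U"
      then have "\<exists>V. openin X V \<and> x \<in> V \<and> V \<subseteq> U" if "x \<in> U" for x
        unfolding arbitrary_union_of_alt using R that by metis
      then show "openin X U"
        using openin_subopen[of X U] by simp
    qed
  qed
qed

lemma compactin_between_base:
  assumes "base_of X \<B>" "compactin X K" "openin X U" "K \<subseteq> U"
  obtains F where "F \<in> Fpow \<B>" "K \<subseteq> \<Union>F" "\<Union>F \<subseteq> U"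
proof -
  let ?C = "{V \<in> \<B>. V \<subseteq> U}"
  have base: "\<And>V. V \<in> \<B> \<Longrightarrow> openin X V" "\<And>x. x \<in> U \<Longrightarrow> \<exists>V\<in>\<B>. x \<in> V \<and> V \<subseteq> U"
    using assms(1,3) by (simp_all add: base_of_iff)
  have "K \<subseteq> \<Union>?C"
    using base(2) assms(4) by fast
  then have "\<exists>F. finite F \<and> F \<subseteq> ?C \<and> K \<subseteq> \<Union>F"
    using base(1) by (intro compactinD[OF assms(2)]) auto
  then obtain F where F: "finite F" "F \<subseteq> ?C" "K \<subseteq> \<Union>F"
    by auto
  show thesis
  proof (rule that)
    show "F \<in> Fpow \<B>" using F(1,2) by (auto simp: Fpow_def)
    show "\<Union>F \<subseteq> U" using F(2) by blast
  qed (rule F(3))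
qed

text \<open>
  A finite base would separate only finitely many points, since in a \<open>T\<^sub>1\<close> space a point is
  determined by the base sets that contain it.
\<close>
lemma infinite_base:
  assumes "t1_space X" "infinite (topspace X)" "base_of X \<B>"
  shows "infinite \<B>"
proof
  assume "finite \<B>"
  have "inj_on (\<lambda>x. {V\<in>\<B>. x \<in> V}) (topspace X)"
  proof (rule inj_onI, rule ccontr)
    fix x y assume xy: "x \<in> topspace X" "y \<in> topspace X" "x \<noteq> y"
      and eq: "{V\<in>\<B>. x \<in> V} = {V\<in>\<B>. y \<in> V}"
    obtain U where "openin X U" "x \<in> U" "y \<notin> U"
      using assms(1) xy unfolding t1_space_def by metis
    then obtain V where V: "V \<in> \<B>" "x \<in> V" "V \<subseteq> U"
      using assms(3) unfolding base_of_iff by metis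
    then have "V \<in> {V\<in>\<B>. y \<in> V}" unfolding eq[symmetric] by simp
    then show False using V(3) \<open>y \<notin> U\<close> by auto
  qed
  moreover have "(\<lambda>x. {V\<in>\<B>. x \<in> V}) ` topspace X \<subseteq> Pow \<B>" by blast
  ultimately have "finite (topspace X)"
    using \<open>finite \<B>\<close> by (meson finite_Pow_iff finite_imageD finite_subset)
  then show False using assms(2) by simp
qed

text \<open>
  \<open>|S| ^c natLeq\<close> is the cardinality of the set of sequences in \<open>S\<close>; the following two rules reduce
  comparisons with it to injections from or to sequences.
\<close>
lemma card_le_cexp_natLeqI:
  assumes "inj_on \<Phi> V" "\<And>v (n::nat). v \<in> V \<Longrightarrow> \<Phi> v n \<in> S"
  shows "|V| \<le>o |S| ^c natLeq"
proof -
  have "\<Phi> ` V \<subseteq> Func UNIV S"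
    using assms(2) by (auto simp: Func_def)
  then have "|V| \<le>o |Func (UNIV::nat set) S|"
    using assms(1) card_of_ordLeq by blast
  then show ?thesis by (simp add: cexp_def Field_card_of Field_natLeq)
qed

lemma cexp_natLeq_card_leI:
  assumes "inj_on \<Phi> {s. \<forall>n::nat. s n \<in> S}" "\<And>s. (\<And>n. s n \<in> S) \<Longrightarrow> \<Phi> s \<in> V"
  shows "|S| ^c natLeq \<le>o |V|"
proof -
  have "Func UNIV S = {s. \<forall>n::nat. s n \<in> S}"
    by (auto simp: Func_def)
  then have "|Func (UNIV::nat set) S| \<le>o |V|"
    using assms by (intro card_of_ordLeqI[of \<Phi>]) auto
  then show ?thesis by (simp add: cexp_def Field_card_of Field_natLeq)
qed

section \<open>Independent families and the cardinality of a span\<close>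

context vector_space
begin

text \<open>
  The usual criterion for indexed families. It also yields injectivity of the indexing, because two
  equal members of the family satisfy the nontrivial relation with coefficients \<open>1\<close> and \<open>-1\<close>.
\<close>
lemma independent_family:
  assumes "\<And>T a t. finite T \<Longrightarrow> T \<subseteq> I \<Longrightarrow> (\<Sum>i\<in>T. scale (a i) (e i)) = 0 \<Longrightarrow> t \<in> T \<Longrightarrow> a t = 0"
  shows "inj_on e I" "independent (e ` I)"
proof -
  show inj: "inj_on e I"
  proof (rule inj_onI, rule ccontr)
    fix i j assume ij: "i \<in> I" "j \<in> I" "e i = e j" "i \<noteq> j"
    have "(\<Sum>k\<in>{i,j}. scale (if k = i then 1 else -1) (e k)) = 0"
      using ij by simp
    from assms[OF _ _ this, of i] ij show False by simp
  qed
  show "independent (e ` I)"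
  proof
    assume "dependent (e ` I)"
    then obtain S u v where S: "finite S" "S \<subseteq> e ` I" "(\<Sum>v\<in>S. scale (u v) v) = 0" "v \<in> S" "u v \<noteq> 0"
      unfolding dependent_explicit by blast
    then obtain T where T: "T \<subseteq> I" "finite T" "S = e ` T"
      by (meson finite_subset_image)
    have "(\<Sum>i\<in>T. scale (u (e i)) (e i)) = 0"
      using S(3) inj_on_subset[OF inj T(1)] by (simp add: T(3) sum.reindex)
    from assms[OF T(2,1) this] S T show False by blast
  qed
qed

text \<open>
  A vector is determined by the finite graph of its nonzero coordinates, a finite subset of
  \<open>B \<times> UNIV\<close>; for infinite \<open>B\<close> at least as large as the scalar field there are only \<open>|B|\<close> such
  subsets.
\<close>
lemma card_span_le:
  assumes "independent B" "infinite B" "|UNIV :: 'a set| \<le>o |B|"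
  shows "|span B| \<le>o |B|"
proof -
  define \<Phi> where "\<Phi> v = (\<lambda>b. (b, representation B v b)) ` {b. representation B v b \<noteq> 0}" for v
  have "\<Phi> v \<in> Fpow (B \<times> UNIV)" for v
    using finite_representation[of B v] representation_ne_zero[of B v]
    by (auto simp: \<Phi>_def Fpow_def)
  moreover have "inj_on \<Phi> (span B)"
  proof (rule inj_onI)
    fix v w assume vw: "v \<in> span B" "w \<in> span B" "\<Phi> v = \<Phi> w"
    have \<Phi>_iff: "(b, c) \<in> \<Phi> u \<longleftrightarrow> c = representation B u b \<and> c \<noteq> 0" for b c u
      by (auto simp: \<Phi>_def)
    have "representation B v b = representation B w b" for b
      using \<Phi>_iff[of b _ v] \<Phi>_iff[of b _ w] vw(3) by metis
    then have "representation B v = representation B w" by auto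
    then show "v = w"
      using sum_nonzero_representation_eq[OF assms(1)] vw by metis
  qed
  ultimately have "|span B| \<le>o |Fpow (B \<times> (UNIV::'a set))|"
    by (intro card_of_ordLeqI[of \<Phi>]) auto
  also have "|Fpow (B \<times> (UNIV::'a set))| =o |B \<times> (UNIV::'a set)|"
    using assms(2) by (intro card_of_Fpow_infinite) (auto simp: finite_cartesian_product_iff)
  also have "|B \<times> (UNIV::'a set)| =o |B|"
    using card_of_Times_infinite[OF assms(2) _ assms(3)] by auto
  finally show ?thesis .
qed

end

section \<open>Continuous functions\<close>

lemma of_real_comp_cont_funs:
  assumes "f \<in> cont_funs X"
  shows "(\<lambda>x. of_real (f x) :: 'k::real_normed_field) \<in> cont_funs X"
proof -
  have "continuous_map X euclidean ((of_real :: real \<Rightarrow> 'k) \<circ> f)"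
    using assms by (intro continuous_map_compose[of X euclideanreal])
      (auto simp: cont_funs_def intro!: continuous_intros)
  then show ?thesis
    using assms by (auto simp: cont_funs_def o_def)
qed

definition unit_funs :: "'a topology \<Rightarrow> ('a \<Rightarrow> real) set" where
  "unit_funs X = {f \<in> cont_funs X. \<forall>x. f x \<in> {0..1}}"

text \<open>Urysohn's lemma, for the extensions by zero that represent continuous functions here.\<close>
lemma unit_fun_bump:
  assumes "compact_space X" "Hausdorff_space X" "openin X U" "x \<in> U"
  obtains f where "f \<in> unit_funs X" "f x = 1" "\<And>y. y \<notin> U \<Longrightarrow> f y = 0"
proof -
  have "completely_regular_space X"
    using assms normal_imp_completely_regular_space compact_Hausdorff_or_regular_imp_normal_space
    by blast
  moreover have "closedin X (topspace X - U)" "x \<in> topspace X - (topspace X - U)"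
    using assms openin_subset by auto
  ultimately obtain f :: "'a \<Rightarrow> real" where f: "continuous_map X (top_of_set {0..1}) f" "f x = 0"
    "f ` (topspace X - U) \<subseteq> {1}"
    unfolding completely_regular_space_def by meson
  define h where "h y = (if y \<in> topspace X then 1 - f y else 0)" for y
  have "continuous_map X euclideanreal (\<lambda>y. 1 - f y)"
    using f(1) by (intro continuous_intros) (auto simp: continuous_map_in_subtopology)
  then have "continuous_map X euclideanreal h"
    by (rule continuous_map_eq) (simp add: h_def)
  moreover have "h y \<in> {0..1}" for y
    using f(1) by (auto simp: h_def continuous_map_in_subtopology Pi_iff)
  ultimately have "h \<in> unit_funs X"
    by (auto simp: unit_funs_def cont_funs_def h_def)
  moreover have "h x = 1" using assms f openin_subset by (fastforce simp: h_def)
  moreover have "h y = 0" if "y \<notin> U" for y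
    using that f(3) by (auto simp: h_def)
  ultimately show thesis using that by blast
qed

section \<open>Rapidly converging sums\<close>

text \<open>
  The ratio \<open>1/8\<close> makes a tail of terms of size at most \<open>1\<close> smaller than half of the term before it:
  \<open>1/8 + 1/64 + ... = 1/7 < 1/2\<close>.
\<close>
definition octal_sum :: "(nat \<Rightarrow> 'a \<Rightarrow> real) \<Rightarrow> 'a \<Rightarrow> real" where
  "octal_sum s x = suminf (\<lambda>n. s n x / 8 ^ n)"

lemma octal_summable:
  fixes a :: "nat \<Rightarrow> real"
  assumes "\<And>n. \<bar>a n\<bar> \<le> 1"
  shows "summable (\<lambda>n. a n / 8 ^ n)"
proof (rule summable_comparison_test')
  show "summable (\<lambda>n. (1/8::real) ^ n)" by (rule summable_geometric) simp
  show "norm (a n / 8 ^ n) \<le> (1/8) ^ n" if "n \<ge> 0" for n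
    using assms[of n] by (simp add: power_one_over divide_right_mono)
qed

lemma octal_tail_le:
  fixes a :: "nat \<Rightarrow> real"
  assumes "\<And>n. \<bar>a n\<bar> \<le> 1"
  shows "\<bar>suminf (\<lambda>i. a (i + n) / 8 ^ (i + n))\<bar> \<le> (8/7) / 8 ^ n"
proof -
  have g: "(\<lambda>i. (1 / 8 ^ n) * (1/8::real) ^ i) sums ((1 / 8 ^ n) * (1 / (1 - 1/8)))"
    by (intro sums_mult geometric_sums) simp
  have "norm (a (i + n) / 8 ^ (i + n)) \<le> (1 / 8 ^ n) * (1/8) ^ i" for i
    using assms[of "i + n"] by (simp add: power_add power_one_over divide_simps)
  then have "norm (suminf (\<lambda>i. a (i + n) / 8 ^ (i + n))) \<le> suminf (\<lambda>i. (1 / 8 ^ n) * (1/8) ^ i)"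
    using g by (intro norm_suminf_le sums_summable) auto
  then show ?thesis
    using sums_unique[OF g] by simp
qed

text \<open>
  Up to the first difference at \<open>n\<close> the two sums agree; there they move apart by at least
  \<open>(1/2) / 8 ^ n\<close>, while all later terms together contribute at most \<open>(1/7) / 8 ^ n\<close>.
\<close>
lemma octal_neq:
  fixes a b :: "nat \<Rightarrow> real"
  assumes "\<And>n. a n \<in> {0..1}" "\<And>n. b n \<in> {0..1}"
    and "\<And>i. i < n \<Longrightarrow> a i = b i" "\<bar>a n - b n\<bar> \<ge> 1/2"
  shows "suminf (\<lambda>n. a n / 8 ^ n) \<noteq> suminf (\<lambda>n. b n / 8 ^ n)"
proof
  assume eq: "suminf (\<lambda>n. a n / 8 ^ n) = suminf (\<lambda>n. b n / 8 ^ n)"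
  define d where "d n = a n - b n" for n
  have d1: "\<bar>d i\<bar> \<le> 1" for i
    using assms(1,2)[of i] by (auto simp: d_def)
  have ab: "\<bar>a i\<bar> \<le> 1" "\<bar>b i\<bar> \<le> 1" for i
    using assms(1,2)[of i] by auto
  have "suminf (\<lambda>i. d i / 8 ^ i) = 0"
    using suminf_diff[OF octal_summable[of a] octal_summable[of b]] ab eq
    by (simp add: d_def diff_divide_distrib)
  also have "suminf (\<lambda>i. d i / 8 ^ i) =
      suminf (\<lambda>i. d (i + Suc n) / 8 ^ (i + Suc n)) + (\<Sum>i<Suc n. d i / 8 ^ i)"
    by (rule suminf_split_initial_segment) (rule octal_summable[OF d1])
  also have "(\<Sum>i<Suc n. d i / 8 ^ i) = d n / 8 ^ n"
    using assms(3) by (simp add: d_def)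
  finally have "\<bar>d n / 8 ^ n\<bar> = \<bar>suminf (\<lambda>i. d (i + Suc n) / 8 ^ (i + Suc n))\<bar>"
    by linarith
  also have "\<dots> \<le> (8/7) / 8 ^ Suc n"
    by (rule octal_tail_le[OF d1])
  finally have "\<bar>d n\<bar> \<le> 1/7"
    by (simp add: divide_simps)
  then show False
    using assms(4) by (simp add: d_def)
qed

text \<open>The tail estimate does not depend on the point, so the partial sums converge uniformly.\<close>
lemma octal_sum_cont:
  assumes s: "\<And>n. s n \<in> unit_funs X"
  shows "octal_sum s \<in> cont_funs X"
proof -
  have b: "\<bar>s n x\<bar> \<le> 1" for n x
    using s[of n] by (auto simp: unit_funs_def)
  have "continuous_map X Met_TC.mtopology (octal_sum s)"
  proof (rule Met_TC.continuous_map_uniform_limit[where f = "\<lambda>N x. \<Sum>n<N. s n x / 8 ^ n" and F = sequentially])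
    have "continuous_map X euclideanreal (\<lambda>x. \<Sum>n<N. s n x / 8 ^ n)" for N
    proof (intro continuous_map_sum)
      fix n show "continuous_map X euclideanreal (\<lambda>x. s n x / 8 ^ n)"
        using continuous_map_real_mult_right[of X "s n" "1 / 8 ^ n"] s[of n]
        by (simp add: unit_funs_def cont_funs_def)
    qed simp
    then show "\<forall>\<^sub>F N in sequentially.
        continuous_map X Met_TC.mtopology (\<lambda>x. \<Sum>n<N. s n x / 8 ^ n)"
      by simp
  next
    fix \<epsilon> :: real assume "0 < \<epsilon>"
    have "(\<lambda>N. (8/7) / 8 ^ N :: real) \<longlonglongrightarrow> 0"
      by real_asymp
    then have "\<forall>\<^sub>F N in sequentially. (8/7) / 8 ^ N < \<epsilon>"
      using \<open>0 < \<epsilon>\<close> by (rule order_tendstoD)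
    then show "\<forall>\<^sub>F N in sequentially. \<forall>x\<in>topspace X.
        octal_sum s x \<in> UNIV \<and> dist (\<Sum>n<N. s n x / 8 ^ n) (octal_sum s x) < \<epsilon>"
    proof eventually_elim
      case (elim N)
      show ?case
      proof (intro ballI conjI UNIV_I)
        fix x assume "x \<in> topspace X"
        have "octal_sum s x = suminf (\<lambda>i. s (i + N) x / 8 ^ (i + N)) + (\<Sum>n<N. s n x / 8 ^ n)"
          unfolding octal_sum_def by (intro suminf_split_initial_segment octal_summable b)
        then have "dist (\<Sum>n<N. s n x / 8 ^ n) (octal_sum s x) =
            \<bar>suminf (\<lambda>i. s (i + N) x / 8 ^ (i + N))\<bar>"
          by (simp add: dist_real_def)
        also have "\<dots> \<le> (8/7) / 8 ^ N"
          using octal_tail_le[of "\<lambda>n. s n x" N] b by simp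
        finally show "dist (\<Sum>n<N. s n x / 8 ^ n) (octal_sum s x) < \<epsilon>"
          using elim by simp
      qed
    qed
  qed simp
  then have "continuous_map X euclideanreal (octal_sum s)" by simp
  moreover have "octal_sum s x = 0" if "x \<notin> topspace X" for x
    using s that by (simp add: octal_sum_def unit_funs_def cont_funs_def)
  ultimately show ?thesis by (simp add: cont_funs_def)
qed

section \<open>Sequences of separated functions: the lower bound\<close>

definition half_separated :: "'a topology \<Rightarrow> ('a \<Rightarrow> real) set \<Rightarrow> bool" where
  "half_separated X A \<longleftrightarrow> (\<forall>f\<in>A. \<forall>g\<in>A. f \<noteq> g \<longrightarrow> (\<exists>x\<in>topspace X. \<bar>f x - g x\<bar> \<ge> 1/2))"

text \<open>
  Zorn's lemma. A function at distance at least \<open>1/2\<close> from all members of a maximal separated set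
  could be added to it.
\<close>
lemma maximal_half_separated:
  obtains A where "A \<subseteq> unit_funs X" "half_separated X A"
    "\<And>f. f \<in> unit_funs X \<Longrightarrow> \<exists>g\<in>A. \<forall>x\<in>topspace X. \<bar>f x - g x\<bar> < 1/2"
proof -
  let ?P = "{A. A \<subseteq> unit_funs X \<and> half_separated X A}"
  have "\<exists>M\<in>?P. \<forall>A\<in>?P. M \<subseteq> A \<longrightarrow> A = M"
  proof (rule subset_Zorn')
    fix C assume C: "subset.chain ?P C"
    have "half_separated X (\<Union>C)"
      unfolding half_separated_def
    proof clarify
      fix f g A B assume fg: "f \<in> A" "A \<in> C" "g \<in> B" "B \<in> C" "f \<noteq> g"
      then obtain D where "D \<in> C" "f \<in> D" "g \<in> D"
        using C unfolding subset_chain_def by blast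
      moreover have "half_separated X D"
        using C \<open>D \<in> C\<close> unfolding subset_chain_def by blast
      ultimately show "\<exists>x\<in>topspace X. 1/2 \<le> \<bar>f x - g x\<bar>"
        using \<open>f \<noteq> g\<close> unfolding half_separated_def by blast
    qed
    moreover have "\<Union>C \<subseteq> unit_funs X"
      using C unfolding subset_chain_def by (intro Union_least) auto
    ultimately show "\<Union>C \<in> ?P" by simp
  qed
  then obtain A where A: "A \<subseteq> unit_funs X" "half_separated X A"
    and max: "\<And>B. B \<subseteq> unit_funs X \<Longrightarrow> half_separated X B \<Longrightarrow> A \<subseteq> B \<Longrightarrow> B = A"
    by auto
  have "\<exists>g\<in>A. \<forall>x\<in>topspace X. \<bar>f x - g x\<bar> < 1/2" if f: "f \<in> unit_funs X" for f
  proof (rule ccontr)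
    assume "\<not> ?thesis"
    then have far: "\<exists>x\<in>topspace X. \<bar>f x - g x\<bar> \<ge> 1/2" if "g \<in> A" for g
      using that by (meson not_le)
    then have "half_separated X (insert f A)"
      using A(2) unfolding half_separated_def by (simp add: abs_minus_commute)
    then have "f \<in> A"
      using max[of "insert f A"] A(1) f by auto
    from far[OF this] show False by simp
  qed
  then show thesis using A that by blast
qed

text \<open>
  Let \<open>U\<close> be a neighbourhood of \<open>x\<close> and \<open>f\<close> a Urysohn function with \<open>f x = 1\<close> that vanishes
  outside \<open>U\<close>. Any \<open>g\<close> within distance less than \<open>1/2\<close> of \<open>f\<close> exceeds \<open>1/2\<close> at \<open>x\<close>
  and stays below \<open>1/2\<close> outside \<open>U\<close>.
\<close>
lemma base_of_half_net:
  assumes "compact_space X" "Hausdorff_space X" "A \<subseteq> unit_funs X"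
    and near: "\<And>f. f \<in> unit_funs X \<Longrightarrow> \<exists>g\<in>A. \<forall>x\<in>topspace X. \<bar>f x - g x\<bar> < 1/2"
  shows "base_of X ((\<lambda>g. {x\<in>topspace X. g x > 1/2}) ` A)"
  unfolding base_of_iff
proof (intro conjI ballI allI impI)
  fix V assume "V \<in> (\<lambda>g. {x \<in> topspace X. 1/2 < g x}) ` A"
  then obtain g where g: "g \<in> A" "V = {x \<in> topspace X. g x \<in> {1/2<..}}" by auto
  then have "continuous_map X euclideanreal g"
    using assms(3) by (auto simp: unit_funs_def cont_funs_def)
  then show "openin X V"
    unfolding g(2) by (rule openin_continuous_map_preimage) simp
next
  fix U x assume U: "openin X U" "x \<in> U"
  obtain f where f: "f \<in> unit_funs X" "f x = 1" "\<And>y. y \<notin> U \<Longrightarrow> f y = 0"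
    using unit_fun_bump[OF assms(1,2) U] by blast
  obtain g where g: "g \<in> A" "\<And>y. y \<in> topspace X \<Longrightarrow> \<bar>f y - g y\<bar> < 1/2"
    using near[OF f(1)] by blast
  have "x \<in> topspace X" using U openin_subset by blast
  then have "g x > 1/2" using g(2)[of x] f(2) by linarith
  moreover have "y \<in> U" if "y \<in> topspace X" "g y > 1/2" for y
    using g(2)[OF that(1)] f(3)[of y] that(2) by (cases "y \<in> U") auto
  ultimately show "\<exists>V\<in>(\<lambda>g. {x \<in> topspace X. 1/2 < g x}) ` A. x \<in> V \<and> V \<subseteq> U"
    using g(1) \<open>x \<in> topspace X\<close>
    by (intro bexI[of _ "{x \<in> topspace X. 1/2 < g x}"]) auto
qed

lemma octal_sum_inj:
  assumes "A \<subseteq> unit_funs X" "half_separated X A"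
  shows "inj_on octal_sum {s. \<forall>n. s n \<in> A}"
proof (rule inj_onI, rule ccontr)
  fix s t assume s: "s \<in> {s. \<forall>n. s n \<in> A}" and t: "t \<in> {s. \<forall>n. s n \<in> A}"
    and eq: "octal_sum s = octal_sum t" and "s \<noteq> t"
  then obtain m where "s m \<noteq> t m" by blast
  define n where "n = (LEAST n. s n \<noteq> t n)"
  have n: "s n \<noteq> t n" "\<And>i. i < n \<Longrightarrow> s i = t i"
    unfolding n_def using \<open>s m \<noteq> t m\<close> by (metis (mono_tags) LeastI, metis (mono_tags) not_less_Least)
  obtain x where x: "\<bar>s n x - t n x\<bar> \<ge> 1/2"
    using assms(2) s t n(1) unfolding half_separated_def by blast
  have "s i x \<in> {0..1}" "t i x \<in> {0..1}" for i
    using s t assms(1) by (auto simp: unit_funs_def)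
  from octal_neq[of "\<lambda>i. s i x" "\<lambda>i. t i x", OF this _ x] n(2)
  have "octal_sum s x \<noteq> octal_sum t x"
    by (simp add: octal_sum_def)
  then show False using eq by simp
qed

theorem weight_cexp_le_card_cont_funs:
  assumes "compact_space X" "Hausdorff_space X"
  shows "weight X ^c natLeq \<le>o |cont_funs X :: ('a \<Rightarrow> 'k::real_normed_field) set|"
proof -
  obtain A where A: "A \<subseteq> unit_funs X" "half_separated X A"
    and near: "\<And>f. f \<in> unit_funs X \<Longrightarrow> \<exists>g\<in>A. \<forall>x\<in>topspace X. \<bar>f x - g x\<bar> < 1/2"
    using maximal_half_separated[of X] by metis
  obtain \<B> where \<B>: "weight X = |\<B>|" "\<And>\<C>. base_of X \<C> \<Longrightarrow> |\<B>| \<le>o |\<C>|"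
    using weight_base[of X] by metis
  have "|\<B>| \<le>o |(\<lambda>g. {x\<in>topspace X. g x > 1/2}) ` A|"
    by (intro \<B>(2) base_of_half_net assms A near)
  also have "|(\<lambda>g. {x\<in>topspace X. g x > 1/2}) ` A| \<le>o |A|"
    by (rule card_of_image)
  finally have "weight X ^c natLeq \<le>o |A| ^c natLeq"
    unfolding \<B>(1) by (rule cexp_mono1) (rule natLeq_Card_order)
  also have "|A| ^c natLeq \<le>o |cont_funs X :: ('a \<Rightarrow> 'k) set|"
  proof (rule cexp_natLeq_card_leI)
    show "inj_on (\<lambda>s x. of_real (octal_sum s x) :: 'k) {s. \<forall>n. s n \<in> A}"
      using octal_sum_inj[OF A] by (force simp: inj_on_def fun_eq_iff)
    show "(\<lambda>x. of_real (octal_sum s x) :: 'k) \<in> cont_funs X" if "\<And>n. s n \<in> A" for s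
      using that A(1) by (intro of_real_comp_cont_funs octal_sum_cont) blast
  qed
  finally show ?thesis .
qed

section \<open>Sequences of finite unions of base sets: the upper bound\<close>

text \<open>
  The balls are enumerated by pairs of an index into a countable dense set and a radius \<open>1/(n+1)\<close>.
  If \<open>3/(n+1) < dist x y\<close> and the centre is within \<open>1/(n+1)\<close> of \<open>x\<close>, then it is farther than
  \<open>2/(n+1)\<close> from \<open>y\<close>.
\<close>
lemma separating_balls:
  obtains q :: "nat \<Rightarrow> 'k::euclidean_space" and r :: "nat \<Rightarrow> real"
  where "\<And>x y. x \<noteq> y \<Longrightarrow> \<exists>i. dist x (q i) \<le> r i \<and> dist y (q i) \<ge> 2 * r i" "\<And>i. r i > 0"
proof -
  obtain D :: "'k set" where D: "countable D" "\<And>U. open U \<Longrightarrow> U \<noteq> {} \<Longrightarrow> \<exists>d\<in>D. d \<in> U"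
    using countable_dense_exists by blast
  then have "D \<noteq> {}" using D(2)[of UNIV] by auto
  define q where "q i = from_nat_into D (fst (prod_decode i))" for i
  define r where "r i = 1 / real (Suc (snd (prod_decode i)))" for i
  have "\<exists>i. dist x (q i) \<le> r i \<and> dist y (q i) \<ge> 2 * r i" if "x \<noteq> y" for x y :: 'k
  proof -
    have "dist x y / 3 > 0" using that by simp
    then obtain n where n: "1 / real (Suc n) < dist x y / 3"
      by (rule nat_approx_posE)
    obtain d where d: "d \<in> D" "dist x d < 1 / real (Suc n)"
      using D(2)[of "ball x (1 / real (Suc n))"] by auto
    obtain k where k: "from_nat_into D k = d"
      using from_nat_into_surj[OF D(1) d(1)] by blast
    have "dist y d \<ge> 2 * (1 / real (Suc n))"
      using dist_triangle[of x y d] n d(2) dist_commute[of y d] by linarith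
    then show ?thesis
      using d(2) by (intro exI[of _ "prod_encode (k, n)"]) (auto simp: q_def r_def k)
  qed
  moreover have "r i > 0" for i by (simp add: r_def)
  ultimately show thesis using that by blast
qed

text \<open>A point is determined by the set of indices of the separating balls that contain it.\<close>
lemma card_euclidean_le_reals: "|UNIV :: 'k::euclidean_space set| \<le>o |UNIV :: real set|"
proof -
  obtain q :: "nat \<Rightarrow> 'k" and r where sep: "\<And>x y. x \<noteq> y \<Longrightarrow> \<exists>i. dist x (q i) \<le> r i \<and> dist y (q i) \<ge> 2 * r i"
    and r: "\<And>i. r i > 0"
    using separating_balls by metis
  have "inj (\<lambda>x. {i. dist x (q i) \<le> r i})"
  proof (rule injI, rule ccontr)
    fix x y :: 'k assume eq: "{i. dist x (q i) \<le> r i} = {i. dist y (q i) \<le> r i}" and "x \<noteq> y"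
    then obtain i where i: "dist x (q i) \<le> r i" "dist y (q i) \<ge> 2 * r i"
      using sep by blast
    then have "i \<in> {i. dist y (q i) \<le> r i}" unfolding eq[symmetric] by simp
    then show False using i(2) r[of i] by simp
  qed
  then have "|UNIV :: 'k set| \<le>o |UNIV :: nat set set|"
    by (intro card_of_ordLeqI) auto
  also have "|UNIV :: nat set set| =o |UNIV :: real set|"
    using nat_sets_eqpoll_reals by (simp add: eqpoll_iff_card_of_ordIso)
  finally show ?thesis .
qed

theorem card_cont_funs_le_weight_cexp:
  assumes "compact_space X" "Hausdorff_space X" "infinite (topspace X)"
  shows "|cont_funs X :: ('a \<Rightarrow> 'k::{real_normed_field, euclidean_space}) set| \<le>o weight X ^c natLeq"
proof -
  obtain \<B> where \<B>: "weight X = |\<B>|" "base_of X \<B>"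
    using weight_base[of X] by metis
  obtain q :: "nat \<Rightarrow> 'k" and r where sep: "\<And>x y. x \<noteq> y \<Longrightarrow> \<exists>i. dist x (q i) \<le> r i \<and> dist y (q i) \<ge> 2 * r i"
    and r: "\<And>i. r i > 0"
    using separating_balls by metis
  \<comment> \<open>\<open>F\<close> sandwiches the \<open>i\<close>-th ball condition on \<open>f\<close>; the doubled radius leaves room for
      finitely many base sets by compactness.\<close>
  define approx where "approx f i F \<longleftrightarrow> F \<in> Fpow \<B> \<and>
    {x \<in> topspace X. f x \<in> cball (q i) (r i)} \<subseteq> \<Union>F \<and>
    \<Union>F \<subseteq> {x \<in> topspace X. f x \<in> ball (q i) (2 * r i)}" for f i F
  have ex: "\<exists>F. approx f i F" if f: "f \<in> cont_funs X" for f i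
  proof -
    have c: "continuous_map X euclidean f" using f by (simp add: cont_funs_def)
    have "closedin X {x \<in> topspace X. f x \<in> cball (q i) (r i)}"
      using closedin_continuous_map_preimage[OF c, of "cball (q i) (r i)"] by simp
    then have K: "compactin X {x \<in> topspace X. f x \<in> cball (q i) (r i)}"
      using assms(1) closedin_compact_space by blast
    have U: "openin X {x \<in> topspace X. f x \<in> ball (q i) (2 * r i)}"
      using openin_continuous_map_preimage[OF c, of "ball (q i) (2 * r i)"] by simp
    have "{x \<in> topspace X. f x \<in> cball (q i) (r i)} \<subseteq> {x \<in> topspace X. f x \<in> ball (q i) (2 * r i)}"
      using r[of i] by auto
    then obtain F where "F \<in> Fpow \<B>" "{x \<in> topspace X. f x \<in> cball (q i) (r i)} \<subseteq> \<Union>F"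
      "\<Union>F \<subseteq> {x \<in> topspace X. f x \<in> ball (q i) (2 * r i)}"
      by (rule compactin_between_base[OF \<B>(2) K U])
    then show ?thesis unfolding approx_def by (intro exI[of _ F] conjI)
  qed
  define \<Phi> where "\<Phi> f i = (SOME F. approx f i F)" for f i
  have "approx f i (\<Phi> f i)" if "f \<in> cont_funs X" for f i
    unfolding \<Phi>_def using ex[OF that] by (rule someI_ex)
  then have \<Phi>: "\<Phi> f i \<in> Fpow \<B>"
    "{x \<in> topspace X. f x \<in> cball (q i) (r i)} \<subseteq> \<Union>(\<Phi> f i)"
    "\<Union>(\<Phi> f i) \<subseteq> {x \<in> topspace X. f x \<in> ball (q i) (2 * r i)}" if "f \<in> cont_funs X" for f i
    using that unfolding approx_def by simp_all
  have "inj_on \<Phi> (cont_funs X)"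
  proof (rule inj_onI)
    fix f g assume f: "f \<in> cont_funs X" and g: "g \<in> cont_funs X" and eq: "\<Phi> f = \<Phi> g"
    show "f = g"
    proof
      fix x
      show "f x = g x"
      proof (cases "x \<in> topspace X")
        case True
        show ?thesis
        proof (rule ccontr)
          assume "f x \<noteq> g x"
          then obtain i where i: "dist (f x) (q i) \<le> r i" "dist (g x) (q i) \<ge> 2 * r i"
            using sep by blast
          then have "x \<in> \<Union>(\<Phi> f i)"
            using \<Phi>(2)[OF f, of i] True by (auto simp: dist_commute)
          then show False
            using \<Phi>(3)[OF g, of i] eq i(2) by (auto simp: dist_commute)
        qed
      next
        case False
        then show ?thesis using f g by (simp add: cont_funs_def)
      qed
    qed
  qed
  then have "|cont_funs X :: ('a \<Rightarrow> 'k) set| \<le>o |Fpow \<B>| ^c natLeq"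
    using \<Phi>(1) by (rule card_le_cexp_natLeqI)
  also have "|Fpow \<B>| =o |\<B>|"
    using infinite_base[OF _ assms(3) \<B>(2)] Hausdorff_imp_t1_space[OF assms(2)]
    by (intro card_of_Fpow_infinite) blast
  then have "|Fpow \<B>| ^c natLeq =o weight X ^c natLeq"
    unfolding \<B>(1) by (intro cexp_cong1 natLeq_Card_order)
  finally show ?thesis .
qed

section \<open>Continuum many independent functions\<close>

text \<open>
  Divide by the lowest power with a nonzero coefficient and let \<open>y\<close> tend to \<open>0\<close>: the other terms
  disappear and only that coefficient is left.
\<close>
lemma powr_sum_eq_0_imp_coeff_eq_0:
  fixes a :: "real \<Rightarrow> 'k::real_normed_field"
  assumes "finite T" "y \<longlonglongrightarrow> 0" "\<And>n. y n > 0"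
    and zero: "\<And>n. (\<Sum>t\<in>T. a t * of_real (y n powr t)) = 0" and "t \<in> T"
  shows "a t = 0"
proof (rule ccontr)
  assume "a t \<noteq> 0"
  define S where "S = {t\<in>T. a t \<noteq> 0}"
  define m where "m = Min S"
  have S: "finite S" "S \<noteq> {}" using assms \<open>a t \<noteq> 0\<close> by (auto simp: S_def)
  have m: "m \<in> S" "\<And>t. t \<in> S \<Longrightarrow> m \<le> t" using S by (auto simp: m_def)
  have "a m + (\<Sum>t\<in>S-{m}. a t * of_real (y n powr (t - m))) = 0" for n
  proof -
    have "0 = (\<Sum>t\<in>S. a t * of_real (y n powr t)) * of_real (y n powr (-m))"
      using zero[of n] assms(1) by (subst sum.mono_neutral_left[of T S]) (auto simp: S_def)
    also have "\<dots> = (\<Sum>t\<in>S. a t * of_real (y n powr (t - m)))"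
      by (simp add: sum_distrib_right mult.assoc powr_add[symmetric] flip: of_real_mult)
    also have "\<dots> = a m + (\<Sum>t\<in>S-{m}. a t * of_real (y n powr (t - m)))"
      using S m(1) assms(3)[of n] by (subst sum.remove[of S m]) auto
    finally show ?thesis by simp
  qed
  moreover have "(\<lambda>n. a m + (\<Sum>t\<in>S-{m}. a t * of_real (y n powr (t - m)))) \<longlonglongrightarrow>
      a m + (\<Sum>t\<in>S-{m}. a t * of_real 0)"
  proof (intro tendsto_intros)
    fix t assume "t \<in> S - {m}"
    then have "t - m > 0" using m(2)[of t] by auto
    then show "(\<lambda>n. y n powr (t - m)) \<longlonglongrightarrow> 0"
      using assms(2) assms(3)
      by (intro tendsto_zero_powrI[where b = "t - m"]) (auto intro!: always_eventually less_imp_le)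
  qed
  ultimately have "(\<lambda>n::nat. 0) \<longlonglongrightarrow> a m" by simp
  then have "a m = 0" by (simp add: LIMSEQ_const_iff)
  then show False using m(1) by (simp add: S_def)
qed

text \<open>
  By compactness there is an accumulation point \<open>p\<close>. Choose successively points \<open>x n \<noteq> p\<close>,
  functions \<open>h n\<close> into \<open>[0,1]\<close> and shrinking neighbourhoods \<open>U n\<close> of \<open>p\<close> such that
  \<open>h n (x n) = 1\<close> and \<open>h n\<close> vanishes on \<open>U n\<close>, where all later points lie. At \<open>x n\<close> the sum
  of the \<open>h i / 8 ^ i\<close> loses its first \<open>n\<close> terms, and so has a positive value of order
  \<open>1 / 8 ^ n\<close>.
\<close>
lemma nonneg_fun_small_values:
  assumes "compact_space X" "Hausdorff_space X" "infinite (topspace X)"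
  obtains g :: "'a \<Rightarrow> real" and x where "g \<in> cont_funs X" "\<And>x. g x \<ge> 0"
    "\<And>n::nat. x n \<in> topspace X" "\<And>n. g (x n) > 0" "(\<lambda>n. g (x n)) \<longlonglongrightarrow> 0"
proof -
  obtain p where p: "p \<in> X derived_set_of (topspace X)"
    using compact_space_imp_Bolzano_Weierstrass[OF assms(1,3)] by blast
  then have pX: "p \<in> topspace X" by (simp add: in_derived_set_of)
  \<comment> \<open>The state of the recursive chosen: a point, its function, and a neighbourhood of \<open>p\<close> where
      the function vanishes.\<close>
  define P where "P = (\<lambda>(x, h, U). openin X U \<and> p \<in> U \<and> x \<in> topspace X \<and> h \<in> unit_funs X \<and>
    h x = (1::real) \<and> (\<forall>y\<in>U. h y = 0))"
  have step: "\<exists>x h V. P (x, h, V) \<and> x \<in> U \<and> V \<subseteq> U" if U: "openin X U" "p \<in> U" for U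
  proof -
    obtain x where x: "x \<in> U" "x \<noteq> p" "x \<in> topspace X"
      using p U by (auto simp: in_derived_set_of)
    obtain V W where VW: "openin X V" "openin X W" "x \<in> V" "p \<in> W" "disjnt V W"
      using assms(2) x pX unfolding Hausdorff_space_def by metis
    obtain h where "h \<in> unit_funs X" "h x = 1" "\<And>y. y \<notin> V \<Longrightarrow> h y = 0"
      using unit_fun_bump[OF assms(1,2) VW(1,3)] by blast
    then have "P (x, h, U \<inter> W)"
      using VW x U by (auto simp: P_def disjnt_iff)
    then show ?thesis using x by blast
  qed
  have "\<exists>f. \<forall>n::nat. P (f n) \<and> (fst (f (Suc n)) \<in> snd (snd (f n)) \<and>
      snd (snd (f (Suc n))) \<subseteq> snd (snd (f n)))"
  proof (rule dependent_nat_choice[where P = "\<lambda>_. P"])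
    show "\<exists>z. P z" using step[OF openin_topspace pX] by metis
    fix z :: "'a \<times> ('a \<Rightarrow> real) \<times> 'a set" and n :: nat assume "P z"
    then have "openin X (snd (snd z))" "p \<in> snd (snd z)"
      by (auto simp: P_def split: prod.splits)
    then obtain x h V where "P (x, h, V)" "x \<in> snd (snd z)" "V \<subseteq> snd (snd z)"
      using step by metis
    then show "\<exists>z'. P z' \<and> (fst z' \<in> snd (snd z) \<and> snd (snd z') \<subseteq> snd (snd z))"
      by (intro exI[of _ "(x, h, V)"]) auto
  qed
  then obtain f where Pf: "\<And>n. P (f n)"
    and f: "\<And>n. fst (f (Suc n)) \<in> snd (snd (f n))" "\<And>n. snd (snd (f (Suc n))) \<subseteq> snd (snd (f n))"
    by blast
  define x where "x n = fst (f n)" for n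
  define h where "h n = fst (snd (f n))" for n
  define U where "U n = snd (snd (f n))" for n
  have chosen: "x n \<in> topspace X" "h n \<in> unit_funs X" "h n (x n) = 1" "\<And>y. y \<in> U n \<Longrightarrow> h n y = 0" for n
    using Pf[of n] by (auto simp: P_def x_def h_def U_def split: prod.splits)
  have "U (Suc n) \<subseteq> U n" for n
    unfolding U_def by (rule f(2))
  then have dec: "U n \<subseteq> U m" if "m \<le> n" for m n
    using that by (rule lift_Suc_antimono_le)
  have hx: "h m (x n) = 0" if mn: "m < n" for m n
  proof -
    obtain k where "n = Suc k" "m \<le> k" using mn by (cases n) auto
    then have "x n \<in> U m" using f(1)[of k] dec[of m k] by (auto simp: x_def U_def)
    then show ?thesis by (rule chosen(4))
  qed
  have bd: "0 \<le> h n y" "h n y \<le> 1" for n y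
    using chosen(2)[of n] by (auto simp: unit_funs_def)
  have ab: "\<bar>h n y\<bar> \<le> 1" for n y using bd[of n y] by simp
  have val: "octal_sum h (x n) \<le> (8/7) / 8 ^ n" for n
  proof -
    have "octal_sum h (x n) = suminf (\<lambda>i. h (i + n) (x n) / 8 ^ (i + n)) + (\<Sum>i<n. h i (x n) / 8 ^ i)"
      unfolding octal_sum_def by (intro suminf_split_initial_segment octal_summable ab)
    also have "(\<Sum>i<n. h i (x n) / 8 ^ i) = 0"
      using hx by simp
    finally show ?thesis
      using octal_tail_le[of "\<lambda>i. h i (x n)" n] ab by simp
  qed
  have pos: "octal_sum h (x n) > 0" for n
    unfolding octal_sum_def using chosen(3)[of n] bd
    by (intro suminf_pos2[where i = n] octal_summable ab) auto
  show thesis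
  proof (rule that)
    show "octal_sum h \<in> cont_funs X" by (rule octal_sum_cont) (rule chosen(2))
    show "octal_sum h y \<ge> 0" for y
      unfolding octal_sum_def by (intro suminf_nonneg octal_summable ab) (auto simp: bd)
    show "x n \<in> topspace X" for n by (rule chosen(1))
    show "octal_sum h (x n) > 0" for n by (rule pos)
    have lim: "(\<lambda>n. (8/7) / 8 ^ n :: real) \<longlonglongrightarrow> 0" by real_asymp
    show "(\<lambda>n. octal_sum h (x n)) \<longlonglongrightarrow> 0"
    proof (rule real_tendsto_sandwich[OF _ _ tendsto_const lim])
      show "\<forall>\<^sub>F n in sequentially. 0 \<le> octal_sum h (x n)"
        using pos by (simp add: less_imp_le)
      show "\<forall>\<^sub>F n in sequentially. octal_sum h (x n) \<le> (8/7) / 8 ^ n"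
        using val by simp
    qed
  qed
qed

lemma fun_sum_scale_apply: "(\<Sum>t\<in>T. fun_scale (a t) (e t)) x = (\<Sum>t\<in>T. a t * e t x)"
  by (induction T rule: infinite_finite_induct) (auto simp: fun_scale_def)

lemma continuum_independent_cont_funs:
  assumes "compact_space X" "Hausdorff_space X" "infinite (topspace X)"
  obtains S :: "('a \<Rightarrow> 'k::real_normed_field) set"
  where "S \<subseteq> cont_funs X" "\<not> fun_vs.dependent S" "|UNIV :: real set| \<le>o |S|"
proof -
  obtain g :: "'a \<Rightarrow> real" and x where g: "g \<in> cont_funs X" "\<And>x. g x \<ge> 0"
    "\<And>n::nat. x n \<in> topspace X" "\<And>n. g (x n) > 0" "(\<lambda>n. g (x n)) \<longlonglongrightarrow> 0"
    using nonneg_fun_small_values[OF assms] by metis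
  define e :: "real \<Rightarrow> 'a \<Rightarrow> 'k" where "e t x = of_real (g x powr t)" for t x
  have e_cont: "e t \<in> cont_funs X" if "t > 0" for t
    unfolding e_def
  proof (rule of_real_comp_cont_funs)
    have "continuous_map X (top_of_set {0..}) g"
      using g by (auto simp: cont_funs_def continuous_map_in_subtopology)
    moreover have "continuous_map (top_of_set {0..}) euclideanreal (\<lambda>y. y powr t)"
      using that by (simp, intro continuous_on_powr') auto
    ultimately have "continuous_map X euclideanreal ((\<lambda>y. y powr t) \<circ> g)"
      by (rule continuous_map_compose)
    then show "(\<lambda>x. g x powr t) \<in> cont_funs X"
      using g(1) that by (auto simp: cont_funs_def o_def)
  qed
  have coeff: "a t = 0" if "finite T" "(\<Sum>i\<in>T. fun_scale (a i) (e i)) = 0" "t \<in> T" for T a t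
  proof (rule powr_sum_eq_0_imp_coeff_eq_0[OF that(1) g(5,4) _ that(3)])
    show "(\<Sum>t\<in>T. a t * of_real (g (x n) powr t)) = 0" for n
      using fun_cong[OF that(2), of "x n"] by (simp add: fun_sum_scale_apply e_def)
  qed
  have inj: "inj_on e {0<..}" and ind: "\<not> fun_vs.dependent (e ` {0<..})"
    using fun_vs.independent_family[of "{0<..}" e] coeff by blast+
  \<comment> \<open>\<open>exp\<close> embeds all reals into the admissible exponents, which have to be positive for \<open>g powr t\<close>
      to be continuous at the zeros of \<open>g\<close>.\<close>
  have "inj (\<lambda>t. e (exp t))"
  proof (rule injI)
    fix s t :: real assume "e (exp s) = e (exp t)"
    then have "exp s = exp t" by (rule inj_onD[OF inj]) simp_all
    then show "s = t" by simp
  qed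
  then have "|UNIV :: real set| \<le>o |e ` {0<..}|"
    by (intro card_of_ordLeqI) auto
  then show thesis
    using that[of "e ` {0<..}"] e_cont ind by blast
qed

section \<open>The dimension of the space of continuous functions\<close>

text \<open>
  Up to isomorphism the scalar fields of these classes are \<open>\<real>\<close> and \<open>\<complex>\<close>. The Euclidean structure provides
  separability, hence both the upper bound for the cardinality and at most continuum many scalars.
\<close>
theorem sw_infinite:
  assumes "compact_space X" "Hausdorff_space X" "infinite (topspace X)"
  shows "(sw X :: ('a \<Rightarrow> 'k::{real_normed_field, euclidean_space}) rel) =o weight X ^c natLeq"
proof -
  let ?V = "cont_funs X :: ('a \<Rightarrow> 'k) set"
  obtain S :: "('a \<Rightarrow> 'k) set" where S: "S \<subseteq> ?V" "\<not> fun_vs.dependent S" "|UNIV :: real set| \<le>o |S|"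
    using continuum_independent_cont_funs[OF assms] by metis
  \<comment> \<open>Extending the independent set to a basis makes that basis at least as large as the continuum.\<close>
  obtain B where B: "S \<subseteq> B" "B \<subseteq> ?V" "\<not> fun_vs.dependent B" "?V \<subseteq> fun_vs.span B"
    using fun_vs.maximal_independent_subset_extend[OF S(1,2)] by metis
  have span_B: "fun_vs.span B = ?V"
    using fun_vs.span_minimal[OF B(2) subspace_cont_funs] B(4) by (rule subset_antisym)
  moreover have "fun_vs.span ?V = ?V"
    by (simp add: fun_vs.span_eq_iff subspace_cont_funs)
  ultimately have "fun_vs.span B = fun_vs.span ?V" by (rule trans[OF _ sym])
  then have sw: "(sw X :: ('a \<Rightarrow> 'k) rel) =o |B|"
    unfolding sw_def by (rule fun_vs.hamel_dim_unique[OF B(3)])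
  have R: "|UNIV :: real set| \<le>o |B|"
    using S(3) card_of_mono1[OF B(1)] by (rule ordLeq_transitive)
  have "infinite B"
    by (rule card_of_ordLeq_infinite[OF R]) (rule infinite_UNIV_char_0)
  then have "|fun_vs.span B| \<le>o |B|"
    using ordLeq_transitive[OF card_euclidean_le_reals R] by (rule fun_vs.card_span_le[OF B(3)])
  then have "|?V| \<le>o |B|" unfolding span_B .
  moreover have "|B| \<le>o |?V|"
    using B(2) by (rule card_of_mono1)
  ultimately have "|B| =o |?V|"
    by (simp add: ordIso_iff_ordLeq)
  moreover have "|?V| =o weight X ^c natLeq"
    using card_cont_funs_le_weight_cexp[OF assms] weight_cexp_le_card_cont_funs[OF assms(1,2)]
    by (simp add: ordIso_iff_ordLeq)
  ultimately show ?thesis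
    using sw by (meson ordIso_transitive)
qed

theorem sw_finite:
  assumes "Hausdorff_space X" "finite (topspace X)"
  shows "(sw X :: ('a \<Rightarrow> 'k::real_normed_field) rel) =o |topspace X|"
proof -
  let ?V = "cont_funs X :: ('a \<Rightarrow> 'k) set"
  have "X = discrete_topology (topspace X)"
    using assms finite_topspace_imp_discrete_topology by metis
  then have V: "?V = {f. \<forall>x. x \<notin> topspace X \<longrightarrow> f x = 0}"
    unfolding cont_funs_def
    by (metis (no_types, lifting) continuous_map_from_discrete_topology topspace_euclidean UNIV_I Pi_I)
  define e :: "'a \<Rightarrow> 'a \<Rightarrow> 'k" where "e x = indicator {x}" for x
  have apply_e: "(\<Sum>i\<in>T. fun_scale (a i) (e i)) x = (if x \<in> T then a x else 0)" if "finite T" for T a x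
  proof -
    have "(\<Sum>i\<in>T. fun_scale (a i) (e i)) x = (\<Sum>i\<in>T. if x = i then a i else 0)"
      unfolding fun_sum_scale_apply by (intro sum.cong) (auto simp: e_def indicator_def)
    also have "\<dots> = (if x \<in> T then a x else 0)"
      using that by simp
    finally show ?thesis .
  qed
  have coeff: "a t = 0" if "finite T" "(\<Sum>i\<in>T. fun_scale (a i) (e i)) = 0" "t \<in> T" for T a t
    using fun_cong[OF that(2), of t] apply_e[OF that(1), of a t] that(3) by simp
  have inj: "inj_on e (topspace X)" and ind: "\<not> fun_vs.dependent (e ` topspace X)"
    using fun_vs.independent_family[of "topspace X" e] coeff by blast+
  have "f \<in> fun_vs.span (e ` topspace X)" if "f \<in> ?V" for f
  proof -
    have "f = (\<Sum>i\<in>topspace X. fun_scale (f i) (e i))"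
      using that assms(2) by (auto simp: V apply_e fun_eq_iff)
    also have "\<dots> \<in> fun_vs.span (e ` topspace X)"
      by (intro fun_vs.span_sum fun_vs.span_scale fun_vs.span_base) blast
    finally show ?thesis .
  qed
  moreover have "e ` topspace X \<subseteq> ?V"
    by (auto simp: V e_def indicator_def)
  ultimately have "fun_vs.span (e ` topspace X) = fun_vs.span ?V"
    using fun_vs.span_superset[of ?V] unfolding fun_vs.span_eq by auto
  then have "(sw X :: ('a \<Rightarrow> 'k) rel) =o |e ` topspace X|"
    unfolding sw_def by (rule fun_vs.hamel_dim_unique[OF ind])
  also have "|e ` topspace X| =o |topspace X|"
    using card_of_ordIsoI[OF inj_on_imp_bij_betw[OF inj]] by (rule ordIso_symmetric)
  finally show ?thesis .
qed

theorem proposition3p9: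
  fixes L :: "'a topology"
  assumes "compact_space L" and "Hausdorff_space L"
  shows "(finite (topspace L) \<longrightarrow>
            (sw L :: ('a \<Rightarrow> real) rel) =o |topspace L| \<and>
            (sw L :: ('a \<Rightarrow> complex) rel) =o |topspace L| ) \<and>
         (infinite (topspace L) \<longrightarrow>
            (sw L :: ('a \<Rightarrow> real) rel) =o weight L ^c natLeq \<and>
            (sw L :: ('a \<Rightarrow> complex) rel) =o weight L ^c natLeq)"
  using assms by (simp add: sw_finite sw_infinite)

end
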